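(* Let $\widehat E=E+\varepsilon E_0$ and $\widehat F=F+\varepsilon F_0$ be elements of $\mathbb{D}_n^{\rm CM}$. Then $\widehat E\overset{{\rm G}\text{-}\#}{\leq}\widehat F$ (G-sharp partial order) if and only if $\widehat E\overset{{\rm DM}\text{-}\#}{\leq}\widehat F$ (Dual-minus sharp partial order) and $$(F_0-E_0)EE^{\#}=O,\qquad EE^{\#}(F_0-E_0)=O.$$
   Context: $\varepsilon$ is the dual unit: $\varepsilon\neq 0$, $\varepsilon^2=0$, commuting with reals. $\mathbb{D}^{m\times n}$ is the set of $m\times n$ dual matrices $\widehat E=E+\varepsilon E_0$ with $E,E_0\in\mathbb{R}^{m\times n}$, with the obvious addition, multiplication and transpose $\widehat E^{T}=E^T+\varepsilon E_0^T$. The dual Moore-Penrose generalized inverse (DMPGI) of $\widehat E\in\mathbb{D}^{m\times n}$ is the unique $\widehat X\in\mathbb{D}^{n\times m}$, if it exists, with $\widehat E\widehat X\widehat E=\widehat E$, $\widehat X\widehat E\widehat X=\widehat X$, $(\widehat E\widehat X)^T=\widehat E\widehat X$, $(\widehat X\widehat E)^T=\widehat X\widehat E$. The dual group generalized inverse (DGGI) of $\widehat E\in\mathbb{D}^{n\times n}$ is the $\widehat X\in\mathbb{D}^{n\times n}$, if it exists, with $\widehat E\widehat X\widehat E=\widehat E$, $\widehat X\widehat E\widehat X=\widehat X$, $\widehat E\widehat X=\widehat X\widehat E$. $\mathbb{D}_n^{\rm CM}$ is the set of dual matrices in $\mathbb{D}^{n\times n}$ of dual index one, i.e. (equivalently)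 those whose DGGI exists; for $\widehat E=E+\varepsilon E_0\in\mathbb{D}_n^{\rm CM}$ the DMPGI of $\widehat E$ exists, and the ordinary group inverse $E^{\#}$ of the real matrix $E$ (the unique $X$ with $EXE=E$, $XEX=X$, $EX=XE$) exists. The group dual generalized inverse of such $\widehat E$ is $\widehat E^{g}=E^{\#}-\varepsilon E^{\#}E_0E^{\#}$. Sharp partial order: for real $n\times n$ group invertible matrices $E,F$, $E\overset{\#}{\leq}F$ means $EF=E^2=FE$. Dual-minus sharp partial order: for $\widehat E,\widehat F\in\mathbb{D}_n^{\rm CM}$, $\widehat E\overset{{\rm DM}\text{-}\#}{\leq}\widehat F$ means that $E\overset{\#}{\leq}F$ and the DMPGI of $\widehat F-\widehat E$ exists. G-sharp partial order: for $\widehat E,\widehat F\in\mathbb{D}_n^{\rm CM}$, $\widehat E\overset{{\rm G}\text{-}\#}{\leq}\widehat F$ means $\widehat E^{g}\widehat E=\widehat E^{g}\widehat F$ and $\widehat E\widehat E^{g}=\widehat F\widehat E^{g}$. *)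

theory Defs
  imports "HOL-Analysis.Analysis"
begin

section \<open>Dual numbers\<close>

text \<open>\<open>Dual a b\<close> is the dual number \<open>a + \<epsilon> b\<close>, with standard part \<open>a\<close> and
  infinitesimal part \<open>b\<close>.\<close>

datatype dual = Dual (std: real) (inf_part: real)

instantiation dual :: "{comm_ring_1, real_algebra_1}"
begin

definition zero_dual :: dual where "0 = Dual 0 0"
definition one_dual :: dual where "1 = Dual 1 0"
definition plus_dual :: "dual \<Rightarrow> dual \<Rightarrow> dual"
  where "x + y = Dual (std x + std y) (inf_part x + inf_part y)"
definition uminus_dual :: "dual \<Rightarrow> dual"
  where "- x = Dual (- std x) (- inf_part x)"
definition minus_dual :: "dual \<Rightarrow> dual \<Rightarrow> dual"
  where "x - y = Dual (std x - std y) (inf_part x - inf_part y)"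
definition times_dual :: "dual \<Rightarrow> dual \<Rightarrow> dual"
  where "x * y = Dual (std x * std y) (std x * inf_part y + inf_part x * std y)"
definition scaleR_dual :: "real \<Rightarrow> dual \<Rightarrow> dual"
  where "scaleR r x = Dual (r * std x) (r * inf_part x)"

instance
  by standard
    (auto simp: zero_dual_def one_dual_def plus_dual_def uminus_dual_def minus_dual_def
      times_dual_def scaleR_dual_def algebra_simps)

end

definition eps :: dual where "eps = Dual 0 1"

lemma eps_nonzero: "eps \<noteq> 0"
  by (simp add: eps_def zero_dual_def)

lemma eps_squared: "eps * eps = 0"
  by (simp add: eps_def zero_dual_def times_dual_def)

lemma Dual_eq: "Dual a b = of_real a + eps * of_real b"
  by (simp add: eps_def of_real_def plus_dual_def times_dual_def scaleR_dual_def one_dual_def)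


section \<open>Dual matrices\<close>

text \<open>Dual matrices are the library's matrices over the ring of dual numbers, with the
  library's addition, product and transpose. \<open>dual_mat A B\<close> is \<open>A + \<epsilon> B\<close>.\<close>

definition dual_mat :: "real ^ 'n ^ 'm \<Rightarrow> real ^ 'n ^ 'm \<Rightarrow> dual ^ 'n ^ 'm"
  where "dual_mat A B = (\<chi> i j. Dual (A $ i $ j) (B $ i $ j))"

definition std_mat :: "dual ^ 'n ^ 'm \<Rightarrow> real ^ 'n ^ 'm"
  where "std_mat A = (\<chi> i j. std (A $ i $ j))"

definition inf_mat :: "dual ^ 'n ^ 'm \<Rightarrow> real ^ 'n ^ 'm"
  where "inf_mat A = (\<chi> i j. inf_part (A $ i $ j))"

lemma std_mat_dual_mat [simp]: "std_mat (dual_mat A B) = A"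
  by (simp add: std_mat_def dual_mat_def vec_eq_iff)

lemma inf_mat_dual_mat [simp]: "inf_mat (dual_mat A B) = B"
  by (simp add: inf_mat_def dual_mat_def vec_eq_iff)

lemma dual_mat_std_inf [simp]: "dual_mat (std_mat A) (inf_mat A) = A"
  by (simp add: std_mat_def inf_mat_def dual_mat_def vec_eq_iff)

lemma std_sum: "std (sum f S) = (\<Sum>k\<in>S. std (f k))"
  by (induction S rule: infinite_finite_induct) (auto simp: zero_dual_def plus_dual_def)

lemma inf_part_sum: "inf_part (sum f S) = (\<Sum>k\<in>S. inf_part (f k))"
  by (induction S rule: infinite_finite_induct) (auto simp: zero_dual_def plus_dual_def)

lemma dual_mat_add: "dual_mat A A0 + dual_mat B B0 = dual_mat (A + B) (A0 + B0)"
  by (simp add: dual_mat_def vec_eq_iff plus_dual_def)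

lemma dual_mat_diff: "dual_mat A A0 - dual_mat B B0 = dual_mat (A - B) (A0 - B0)"
  by (simp add: dual_mat_def vec_eq_iff minus_dual_def)

lemma dual_mat_transpose: "transpose (dual_mat A A0) = dual_mat (transpose A) (transpose A0)"
  by (simp add: dual_mat_def transpose_def vec_eq_iff)

lemma dual_mat_mult: "dual_mat A A0 ** dual_mat B B0 = dual_mat (A ** B) (A ** B0 + A0 ** B)"
  by (auto simp: dual_mat_def matrix_matrix_mult_def vec_eq_iff std_sum inf_part_sum
      times_dual_def sum.distrib intro!: dual.expand)


section \<open>Generalized inverses\<close>

text \<open>The following notions are used both for real matrices and for dual matrices
  (where they give the DGGI and the DMPGI).\<close>

definition is_group_inverse :: "'a::comm_ring_1 ^ 'n ^ 'n \<Rightarrow> 'a ^ 'n ^ 'n \<Rightarrow> bool"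
  where "is_group_inverse A X \<longleftrightarrow>
    A ** X ** A = A \<and> X ** A ** X = X \<and> A ** X = X ** A"

definition is_mp_inverse :: "'a::comm_ring_1 ^ 'n ^ 'm \<Rightarrow> 'a ^ 'm ^ 'n \<Rightarrow> bool"
  where "is_mp_inverse A X \<longleftrightarrow>
    A ** X ** A = A \<and> X ** A ** X = X \<and>
    transpose (A ** X) = A ** X \<and> transpose (X ** A) = X ** A"

lemma is_group_inverse_unique:
  assumes "is_group_inverse A X" and "is_group_inverse A Y"
  shows "X = Y"
proof -
  have A: "A ** X ** A = A" "X ** A ** X = X" "A ** X = X ** A"
    and B: "A ** Y ** A = A" "Y ** A ** Y = Y" "A ** Y = Y ** A"
    using assms by (auto simp: is_group_inverse_def)
  have "A ** X = Y ** (A ** A ** X)"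
    using B by (metis matrix_mul_assoc)
  also have "\<dots> = Y ** A"
    using A by (metis matrix_mul_assoc)
  finally have AX: "A ** X = A ** Y" using B by simp
  have "X = X ** (A ** Y)" using A AX by (metis matrix_mul_assoc)
  also have "\<dots> = Y ** A ** Y" using A B AX by (metis matrix_mul_assoc)
  finally show ?thesis using B by simp
qed

text \<open>\<open>group_inverse A\<close> is \<open>A\<^sup>#\<close>; it is only meaningful when a group inverse of \<open>A\<close> exists.\<close>

definition group_inverse :: "'a::comm_ring_1 ^ 'n ^ 'n \<Rightarrow> 'a ^ 'n ^ 'n"
  where "group_inverse A = (THE X. is_group_inverse A X)"

text \<open>The square dual matrices of dual index one, i.e. those whose DGGI exists.\<close>

definition dual_CM :: "(dual ^ 'n ^ 'n) set"
  where "dual_CM = {A. \<exists>X. is_group_inverse A X}"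

text \<open>The group dual generalized inverse \<open>A\<^sup>g = E\<^sup># - \<epsilon> E\<^sup># E\<^sub>0 E\<^sup>#\<close> of \<open>A = E + \<epsilon> E\<^sub>0\<close> in \<open>dual_CM\<close>;
  in general it differs from the DGGI \<open>group_inverse A\<close>.\<close>

definition group_dual_inverse :: "dual ^ 'n ^ 'n \<Rightarrow> dual ^ 'n ^ 'n"
  where "group_dual_inverse A =
    (let G = group_inverse (std_mat A) in dual_mat G (- (G ** inf_mat A ** G)))"


section \<open>Partial orders\<close>

text \<open>These relations are intended for group invertible real matrices, respectively for
  elements of \<open>dual_CM\<close>; the restriction is imposed where they are used.\<close>

definition sharp_le :: "real ^ 'n ^ 'n \<Rightarrow> real ^ 'n ^ 'n \<Rightarrow> bool"
  where "sharp_le E F \<longleftrightarrow> E ** F = E ** E \<and> E ** E = F ** E"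

definition dual_minus_sharp_le :: "dual ^ 'n ^ 'n \<Rightarrow> dual ^ 'n ^ 'n \<Rightarrow> bool"
  where "dual_minus_sharp_le A B \<longleftrightarrow>
    sharp_le (std_mat A) (std_mat B) \<and> (\<exists>X. is_mp_inverse (B - A) X)"

definition G_sharp_le :: "dual ^ 'n ^ 'n \<Rightarrow> dual ^ 'n ^ 'n \<Rightarrow> bool"
  where "G_sharp_le A B \<longleftrightarrow>
    group_dual_inverse A ** A = group_dual_inverse A ** B \<and>
    A ** group_dual_inverse A = B ** group_dual_inverse A"

end

theory Submission
  imports Defs
begin

text \<open>Comparing standard and infinitesimal parts, the G-sharp order says exactly that
  \<open>E \<le>\<^sup># F\<close> and that \<open>E\<^sup>#\<close> annihilates \<open>F\<^sub>0 - E\<^sub>0\<close> from both sides. It remains to see that these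
  conditions force the DMPGI of the difference to exist. A dual matrix \<open>M + \<epsilon> M\<^sub>0\<close> has an inner
  inverse iff \<open>(1 - M H) M\<^sub>0 (1 - H M) = 0\<close> for an inner inverse \<open>H\<close> of \<open>M\<close>, and then it has a
  DMPGI. For \<open>M = F - E\<close> take \<open>H = F\<^sup># - E\<^sup>#\<close>, so that \<open>1 - M H = (1 - F F\<^sup>#) + E E\<^sup>#\<close>; the
  second summand annihilates \<open>F\<^sub>0 - E\<^sub>0\<close>, and the first one reduces the criterion for the
  difference to those for \<open>E + \<epsilon> E\<^sub>0\<close> and \<open>F + \<epsilon> F\<^sub>0\<close>.\<close>

section \<open>Matrix algebra\<close>

lemma matrix_add_rdistrib:
  fixes A :: "'a::semiring_1 ^ 'n ^ 'm"
  shows "(A + B) ** C = A ** C + B ** C"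
  by (simp add: matrix_matrix_mult_def vec_eq_iff distrib_right sum.distrib)

lemma matrix_diff_ldistrib:
  fixes A :: "'a::ring_1 ^ 'n ^ 'm"
  shows "A ** (B - C) = A ** B - A ** C"
  by (simp add: matrix_matrix_mult_def vec_eq_iff right_diff_distrib sum_subtractf)

lemma matrix_diff_rdistrib:
  fixes A :: "'a::ring_1 ^ 'n ^ 'm"
  shows "(A - B) ** C = A ** C - B ** C"
  by (simp add: matrix_matrix_mult_def vec_eq_iff left_diff_distrib sum_subtractf)

lemma matrix_uminus_left:
  fixes A :: "'a::ring_1 ^ 'n ^ 'm"
  shows "(- A) ** B = - (A ** B)"
  by (simp add: matrix_matrix_mult_def vec_eq_iff sum_negf)

lemma matrix_uminus_right:
  fixes A :: "'a::ring_1 ^ 'n ^ 'm"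
  shows "A ** (- B) = - (A ** B)"
  by (simp add: matrix_matrix_mult_def vec_eq_iff sum_negf)

lemma matrix_zero_left:
  "(0 :: 'a::semiring_1 ^ 'n ^ 'm) ** A = 0"
  by (simp add: matrix_matrix_mult_def vec_eq_iff)

lemma matrix_zero_right:
  "(A :: 'a::semiring_1 ^ 'n ^ 'm) ** 0 = 0"
  by (simp add: matrix_matrix_mult_def vec_eq_iff)

lemma transpose_add: "transpose (A + B) = transpose A + transpose B"
  by (simp add: transpose_def vec_eq_iff)

lemma transpose_diff: "transpose (A - B) = transpose A - transpose B"
  by (simp add: transpose_def vec_eq_iff)

lemmas matrix_distribs = matrix_add_ldistrib matrix_add_rdistrib
  matrix_diff_ldistrib matrix_diff_rdistrib matrix_uminus_left matrix_uminus_right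
  matrix_zero_left matrix_zero_right

lemma mat_1_dual: "mat 1 = dual_mat (mat 1) 0"
  by (simp add: mat_def dual_mat_def vec_eq_iff one_dual_def zero_dual_def)

lemma std_mat_add: "std_mat (A + B) = std_mat A + std_mat B"
  by (simp add: std_mat_def vec_eq_iff plus_dual_def)

lemma std_mat_mult: "std_mat (A ** B) = std_mat A ** std_mat B"
  by (simp add: std_mat_def matrix_matrix_mult_def vec_eq_iff std_sum times_dual_def)

lemma std_mat_transpose: "std_mat (transpose A) = transpose (std_mat A)"
  by (simp add: std_mat_def transpose_def vec_eq_iff)

lemma std_mat_1: "std_mat (mat 1) = mat 1"
  by (simp add: mat_1_dual)

lemma dual_mat_eq_iff: "dual_mat A B = dual_mat C D \<longleftrightarrow> A = C \<and> B = D"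
  by (metis inf_mat_dual_mat std_mat_dual_mat)

text \<open>Since \<open>eps\<close> squares to zero, the inverse of \<open>S + eps Z0\<close> is
  \<open>Y - eps Y Z0 Y\<close> with \<open>Y\<close> the inverse of \<open>S\<close>.\<close>

lemma dual_mat_invertible:
  fixes Z :: "dual ^ 'n ^ 'n"
  assumes "invertible (std_mat Z)"
  obtains W where "Z ** W = mat 1" "W ** Z = mat 1"
proof -
  obtain Y where Y: "std_mat Z ** Y = mat 1" "Y ** std_mat Z = mat 1"
    using assms by (auto simp: invertible_def)
  have YZ: "X ** Y ** std_mat Z = X" for X :: "real ^ 'n ^ 'n"
    using Y(2) by (simp flip: matrix_mul_assoc)
  let ?W = "dual_mat Y (- (Y ** inf_mat Z ** Y))"
  have "dual_mat (std_mat Z) (inf_mat Z) ** ?W = mat 1"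
    "?W ** dual_mat (std_mat Z) (inf_mat Z) = mat 1"
    using Y YZ by (simp_all add: dual_mat_mult mat_1_dual dual_mat_eq_iff matrix_distribs
        matrix_mul_assoc del: dual_mat_std_inf)
  then show ?thesis using that by simp
qed

text \<open>Pairing a kernel vector \<open>x\<close> with its image gives
  \<open>|x|^2 + |K x|^2 = 0\<close>, so the kernel is trivial.\<close>

lemma invertible_one_plus_gram:
  fixes K :: "real ^ 'n ^ 'm"
  shows "invertible (mat 1 + transpose K ** K)"
proof -
  have "x = 0" if "(mat 1 + transpose K ** K) *v x = 0" for x
  proof -
    have "x + transpose K *v (K *v x) = 0"
      using that by (simp add: matrix_vector_mult_add_rdistrib matrix_vector_mul_assoc
          del: transpose_matrix_vector)
    then have "x \<bullet> x + x \<bullet> (transpose K *v (K *v x)) = 0"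
      by (metis inner_add_right inner_zero_right)
    moreover have "x \<bullet> (transpose K *v (K *v x)) = (K *v x) \<bullet> (K *v x)"
      by (metis dot_lmul_matrix inner_commute transpose_matrix_vector)
    ultimately have "x \<bullet> x = 0"
      by (metis add_nonneg_eq_0_iff inner_ge_zero)
    then show ?thesis by simp
  qed
  then show ?thesis
    by (simp add: invertible_left_inverse matrix_left_invertible_ker)
qed

section \<open>Regular dual matrices\<close>

text \<open>The orthogonal projection onto the range of \<open>p\<close> is \<open>p p\<^sup>T z\<^sup>-\<^sup>1\<close> with \<open>z = 1 - (p - p\<^sup>T)\<^sup>2\<close>, which commutes with \<open>p\<close> and \<open>p\<^sup>T\<close>
  and satisfies \<open>p z = p p\<^sup>T p\<close>; it is invertible because its standard part is positive definite.\<close>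

lemma dual_idempotent_projection:
  fixes p :: "dual ^ 'n ^ 'n"
  assumes "p ** p = p"
  obtains q where "transpose q = q" "q ** p = p" "p ** q = q"
proof -
  let ?t = "transpose p"
  define z where "z = mat 1 + transpose (p - ?t) ** (p - ?t)"
  have pp: "p ** p = p" "?t ** ?t = ?t"
    using assms by (simp_all flip: matrix_transpose_mul)
  have ppX: "X ** p ** p = X ** p" "X ** ?t ** ?t = X ** ?t" for X
    using pp by (simp_all flip: matrix_mul_assoc)
  have pz: "p ** z = p ** ?t ** p" "z ** p = p ** ?t ** p"
    and tz: "?t ** z = ?t ** p ** ?t" "z ** ?t = ?t ** p ** ?t"
    by (simp_all add: z_def transpose_diff matrix_distribs matrix_mul_assoc pp ppX)
  have z_sym: "transpose z = z"
    by (simp add: z_def transpose_add matrix_transpose_mul)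
  have "invertible (std_mat z)"
    unfolding z_def std_mat_add std_mat_mult std_mat_transpose std_mat_1
    by (rule invertible_one_plus_gram)
  then obtain w where w: "z ** w = mat 1" "w ** z = mat 1"
    by (rule dual_mat_invertible)
  have w_comm: "w ** X = X ** w" if "X ** z = z ** X" for X
    by (metis that w matrix_mul_assoc matrix_mul_lid matrix_mul_rid)
  have w_sym: "transpose w = w"
    by (metis w z_sym matrix_transpose_mul transpose_mat matrix_mul_assoc matrix_mul_lid
        matrix_mul_rid)
  have pw: "w ** p = p ** w" "w ** ?t = ?t ** w"
    using pz tz by (simp_all add: w_comm)
  let ?q = "p ** ?t ** w"
  have "transpose ?q = ?q"
    by (simp add: matrix_transpose_mul w_sym) (metis pw matrix_mul_assoc)
  moreover have "?q ** p = p"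
    by (metis pw(1) pz(1) w(1) matrix_mul_assoc matrix_mul_rid)
  moreover have "p ** ?q = ?q"
    by (simp add: matrix_mul_assoc pp)
  ultimately show ?thesis by (rule that)
qed

text \<open>\<open>A ** X\<close> is an idempotent with the range of \<open>A\<close>; composing
  \<open>X\<close> with the orthogonal projection \<open>q\<close> onto that range makes the product
  \<open>q\<close>, which is symmetric.\<close>

lemma dual_regular_13_inverse:
  fixes A :: "dual ^ 'n ^ 'm"
  assumes "A ** X ** A = A"
  obtains Y where "A ** Y ** A = A" "transpose (A ** Y) = A ** Y"
proof -
  have "(A ** X) ** (A ** X) = A ** X"
    using assms by (simp add: matrix_mul_assoc)
  then obtain q where q: "transpose q = q" "q ** (A ** X) = A ** X" "A ** X ** q = q"
    by (rule dual_idempotent_projection)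
  have "A ** (X ** q) = q"
    using q by (simp add: matrix_mul_assoc)
  moreover have "q ** A = A"
    by (metis assms q(2) matrix_mul_assoc)
  ultimately show ?thesis
    using that[of "X ** q"] q(1) by simp
qed

lemma dual_regular_mp_inverse:
  fixes A :: "dual ^ 'n ^ 'm"
  assumes "A ** X ** A = A"
  shows "\<exists>Y. is_mp_inverse A Y"
proof -
  obtain Y where Y: "A ** Y ** A = A" "transpose (A ** Y) = A ** Y"
    using assms by (rule dual_regular_13_inverse)
  \<comment> \<open>The same construction for the transpose yields an inner inverse \<open>U\<close>
    with \<open>U ** A\<close> symmetric; \<open>U ** A ** Y\<close> then inherits both
    symmetries.\<close>
  have "transpose A ** transpose X ** transpose A = transpose A"
    using assms by (metis matrix_transpose_mul matrix_mul_assoc)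
  then obtain V where V: "transpose A ** V ** transpose A = transpose A"
    "transpose (transpose A ** V) = transpose A ** V"
    by (rule dual_regular_13_inverse)
  define U where "U = transpose V"
  have U: "A ** U ** A = A" "transpose (U ** A) = U ** A"
    using V unfolding U_def
    by (metis matrix_transpose_mul matrix_mul_assoc transpose_transpose)+
  let ?P = "U ** A ** Y"
  have AP: "A ** ?P = A ** Y" and PA: "?P ** A = U ** A"
    using U(1) Y(1) by (metis matrix_mul_assoc)+
  have "?P ** A ** ?P = ?P"
    using PA AP Y(1) by (metis matrix_mul_assoc)
  then have "is_mp_inverse A ?P"
    using AP PA Y U by (simp add: is_mp_inverse_def)
  then show ?thesis by blast
qed

text \<open>An inner inverse puts \<open>M0\<close> into a sum of a left and a right multiple of
  \<open>M\<close>, which the two outer factors kill. Conversely, the expanded condition makes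
  \<open>H - eps H M0 H\<close> an inner inverse.\<close>

lemma dual_regular_iff:
  fixes M M0 :: "real ^ 'n ^ 'm"
  assumes M: "M ** H ** M = M"
  shows "(\<exists>X. dual_mat M M0 ** X ** dual_mat M M0 = dual_mat M M0) \<longleftrightarrow>
    (mat 1 - M ** H) ** M0 ** (mat 1 - H ** M) = 0"
proof
  assume "\<exists>X. dual_mat M M0 ** X ** dual_mat M M0 = dual_mat M M0"
  then obtain X where "dual_mat M M0 ** X ** dual_mat M M0 = dual_mat M M0" by blast
  then have "dual_mat M M0 ** dual_mat (std_mat X) (inf_mat X) ** dual_mat M M0 = dual_mat M M0"
    by simp
  then have M0: "M0 = M ** std_mat X ** M0 + (M ** inf_mat X + M0 ** std_mat X) ** M"
    unfolding dual_mat_mult dual_mat_eq_iff by simp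
  have ann: "(mat 1 - M ** H) ** M = 0" "M ** (mat 1 - H ** M) = 0"
    using M by (simp_all add: matrix_distribs matrix_mul_assoc)
  have "(mat 1 - M ** H) ** M0 ** (mat 1 - H ** M) =
     ((mat 1 - M ** H) ** M) ** std_mat X ** M0 ** (mat 1 - H ** M)
     + (mat 1 - M ** H) ** (M ** inf_mat X + M0 ** std_mat X) ** (M ** (mat 1 - H ** M))"
    by (subst M0) (simp only: matrix_add_ldistrib matrix_add_rdistrib matrix_mul_assoc)
  then show "(mat 1 - M ** H) ** M0 ** (mat 1 - H ** M) = 0"
    by (simp add: ann matrix_zero_left matrix_zero_right)
next
  assume "(mat 1 - M ** H) ** M0 ** (mat 1 - H ** M) = 0"
  then have "M0 - M ** H ** M0 - M0 ** H ** M + M ** H ** M0 ** H ** M = 0"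
    by (simp add: matrix_distribs matrix_mul_assoc algebra_simps)
  then have "dual_mat M M0 ** dual_mat H (- (H ** M0 ** H)) ** dual_mat M M0 = dual_mat M M0"
    by (simp add: dual_mat_mult dual_mat_eq_iff M matrix_distribs matrix_mul_assoc algebra_simps)
  then show "\<exists>X. dual_mat M M0 ** X ** dual_mat M M0 = dual_mat M M0" by blast
qed

section \<open>The sharp orders\<close>

lemma dual_CM_std:
  fixes E E0 :: "real ^ 'n ^ 'n"
  assumes "dual_mat E E0 \<in> dual_CM"
  shows "is_group_inverse E (group_inverse E)"
    and "(mat 1 - E ** group_inverse E) ** E0 ** (mat 1 - group_inverse E ** E) = 0"
proof -
  obtain X where X: "is_group_inverse (dual_mat E E0) X"
    using assms by (auto simp: dual_CM_def)
  then have "is_group_inverse E (std_mat X)"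
    unfolding is_group_inverse_def by (metis std_mat_mult std_mat_dual_mat)
  then show G: "is_group_inverse E (group_inverse E)"
    unfolding group_inverse_def by (metis theI is_group_inverse_unique)
  \<comment> \<open>The DGGI is in particular an inner inverse, so the regularity criterion applies
    with \<open>H\<close> the group inverse of \<open>E\<close>.\<close>
  show "(mat 1 - E ** group_inverse E) ** E0 ** (mat 1 - group_inverse E ** E) = 0"
    using X G unfolding is_group_inverse_def by (metis dual_regular_iff)
qed

text \<open>Multiplication by \<open>G ** G\<close> or \<open>E ** E\<close> passes between the two
  forms, because \<open>G ** G ** E = G\<close> and \<open>E ** E ** G = E\<close>.\<close>

lemma sharp_le_iff_group_inverse:
  assumes "is_group_inverse E G"
  shows "sharp_le E F \<longleftrightarrow> G ** E = G ** F \<and> E ** G = F ** G"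
proof -
  have G: "E ** G ** E = E" "G ** E ** G = G" "E ** G = G ** E"
    using assms by (auto simp: is_group_inverse_def)
  have "E ** F = E ** E \<longleftrightarrow> G ** E = G ** F"
    using G by (metis matrix_mul_assoc)
  moreover have "E ** E = F ** E \<longleftrightarrow> E ** G = F ** G"
    using G by (metis matrix_mul_assoc)
  ultimately show ?thesis by (simp add: sharp_le_def)
qed

lemma G_sharp_le_iff:
  fixes E E0 F F0 :: "real ^ 'n ^ 'n"
  assumes "is_group_inverse E (group_inverse E)"
  shows "G_sharp_le (dual_mat E E0) (dual_mat F F0) \<longleftrightarrow>
    sharp_le E F \<and> (F0 - E0) ** E ** group_inverse E = 0 \<and> E ** group_inverse E ** (F0 - E0) = 0"
proof -
  let ?G = "group_inverse E"
  have G: "?G ** E ** ?G = ?G" "E ** ?G = ?G ** E"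
    using assms by (auto simp: is_group_inverse_def)
  have l: "E ** ?G ** (F0 - E0) = 0 \<longleftrightarrow> ?G ** (F0 - E0) = 0"
    using G by (metis matrix_mul_assoc matrix_zero_right)
  have r: "(F0 - E0) ** E ** ?G = 0 \<longleftrightarrow> (F0 - E0) ** ?G = 0"
    using G by (metis matrix_mul_assoc matrix_zero_left)
  have std: "sharp_le E F \<longleftrightarrow> ?G ** E = ?G ** F \<and> E ** ?G = F ** ?G"
    using assms by (rule sharp_le_iff_group_inverse)
  \<comment> \<open>With this the correction terms from \<open>- G E0 G\<close> agree on both sides,
    so the infinitesimal parts compare only \<open>E0\<close> with \<open>F0\<close>.\<close>
  have swap: "X ** ?G ** E = X ** ?G ** F" if "?G ** E = ?G ** F" for X
    using that by (simp flip: matrix_mul_assoc)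
  show ?thesis
    unfolding l r std
    by (auto simp: G_sharp_le_def group_dual_inverse_def Let_def dual_mat_mult dual_mat_eq_iff
        matrix_distribs matrix_mul_assoc swap)
qed

lemma sharp_le_diff_group_inverse:
  fixes E F :: "real ^ 'n ^ 'n"
  assumes "is_group_inverse E G" "is_group_inverse F H" "sharp_le E F"
  shows "(F - E) ** (H - G) = F ** H - E ** G" and "(H - G) ** (F - E) = H ** F - G ** E"
    and "(F - E) ** (H - G) ** (F - E) = F - E"
    and "F ** H ** E ** G = E ** G" and "G ** E ** H ** F = G ** E"
proof -
  have G: "E ** G ** E = E" "E ** G = G ** E"
    and H: "F ** H ** F = F" "F ** H = H ** F"
    using assms by (auto simp: is_group_inverse_def)
  have S: "G ** E = G ** F" "E ** G = F ** G"
    using assms sharp_le_iff_group_inverse by blast+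
  have E: "F ** H ** E = E" "E ** H ** F = E" "E ** G ** F = E"
    using G H S by (metis matrix_mul_assoc)+
  \<comment> \<open>\<open>E\<close> and \<open>F\<close> agree on the range of \<open>E\<close>,
    hence so do \<open>G\<close> and \<open>H\<close>; thus every cross term in the products below
    is \<open>E ** G\<close>.\<close>
  have EH: "E ** H = G ** E" "H ** E = E ** G"
    using G H S E by (metis matrix_mul_assoc)+
  show FH: "(F - E) ** (H - G) = F ** H - E ** G"
    and "(H - G) ** (F - E) = H ** F - G ** E"
    using G S EH by (simp_all add: matrix_distribs)
  show "(F - E) ** (H - G) ** (F - E) = F - E"
    unfolding FH by (simp add: matrix_distribs G(1) H(1) E)
  show "F ** H ** E ** G = E ** G"
    by (simp add: E)
  show "G ** E ** H ** F = G ** E"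
    using E by (metis matrix_mul_assoc)
qed

lemma dual_diff_mp_inverse:
  fixes E E0 F F0 :: "real ^ 'n ^ 'n"
  assumes "dual_mat E E0 \<in> dual_CM" and "dual_mat F F0 \<in> dual_CM" and le: "sharp_le E F"
    and z: "(F0 - E0) ** E ** group_inverse E = 0" "E ** group_inverse E ** (F0 - E0) = 0"
  shows "\<exists>X. is_mp_inverse (dual_mat F F0 - dual_mat E E0) X"
proof -
  let ?G = "group_inverse E" and ?H = "group_inverse F"
  let ?M0 = "F0 - E0" and ?L = "mat 1 - F ** ?H" and ?R = "mat 1 - ?H ** F"
  note E = dual_CM_std[OF assms(1)] and F = dual_CM_std[OF assms(2)]
  note K = sharp_le_diff_group_inverse[OF E(1) F(1) le]
  have comm: "?G ** E = E ** ?G"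
    using E(1) by (simp add: is_group_inverse_def)
  \<comment> \<open>The range of \<open>E\<close> lies in that of \<open>F\<close>, and dually for
    kernels, so the projections for \<open>F\<close> absorb those for \<open>E\<close> and the
    criterion for \<open>E0\<close> also gives \<open>?L ** E0 ** ?R = 0\<close>.\<close>
  have LR: "?L = ?L ** (mat 1 - E ** ?G)" "?R = (mat 1 - ?G ** E) ** ?R"
    using K(4,5) by (simp_all add: matrix_distribs matrix_mul_assoc)
  have "?L ** E0 ** ?R = ?L ** ((mat 1 - E ** ?G) ** E0 ** (mat 1 - ?G ** E)) ** ?R"
    by (metis LR matrix_mul_assoc)
  then have "?L ** ?M0 ** ?R = 0"
    using E(2) F(2) by (simp add: matrix_diff_ldistrib[of ?L] matrix_diff_rdistrib[of "_ ** F0"]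
        matrix_zero_left matrix_zero_right)
  moreover have "?M0 ** (?G ** E) = 0"
    using z(1) comm by (simp add: matrix_mul_assoc)
  then have "(?L + E ** ?G) ** ?M0 ** (?R + ?G ** E) = ?L ** ?M0 ** ?R"
    by (simp only: matrix_add_ldistrib matrix_add_rdistrib z(2) matrix_zero_left
        matrix_zero_right add_0_right flip: matrix_mul_assoc)
      (simp only: matrix_mul_assoc z(2) matrix_zero_left add_0_right)
  moreover have "mat 1 - (F - E) ** (?H - ?G) = ?L + E ** ?G"
    "mat 1 - (?H - ?G) ** (F - E) = ?R + ?G ** E"
    unfolding K by simp_all
  ultimately have "(mat 1 - (F - E) ** (?H - ?G)) ** ?M0 ** (mat 1 - (?H - ?G) ** (F - E)) = 0"
    by (simp only:)
  then obtain X where "dual_mat (F - E) ?M0 ** X ** dual_mat (F - E) ?M0 = dual_mat (F - E) ?M0"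
    using dual_regular_iff[OF K(3)] by blast
  then show ?thesis
    unfolding dual_mat_diff by (rule dual_regular_mp_inverse)
qed

theorem theorem4p8:
  fixes E E0 F F0 :: "real ^ 'n ^ 'n"
  assumes "dual_mat E E0 \<in> dual_CM" and "dual_mat F F0 \<in> dual_CM"
  shows "G_sharp_le (dual_mat E E0) (dual_mat F F0) \<longleftrightarrow>
    dual_minus_sharp_le (dual_mat E E0) (dual_mat F F0) \<and>
    (F0 - E0) ** E ** group_inverse E = 0 \<and>
    E ** group_inverse E ** (F0 - E0) = 0"
  using G_sharp_le_iff[OF dual_CM_std(1)[OF assms(1)]] dual_diff_mp_inverse[OF assms]
  by (auto simp: dual_minus_sharp_le_def)

end
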